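(* Let $D=(V,E,F)$ be a P-graph with a P-labeling $\mu$, let $z:V\to\mathbb{R}^2\cong\mathbb{C}$ be a P-net, and let $N:V\to\mathbb{S}^2$ be the inverse stereographic projection of $z$. Let $(f,\tilde f)$ be the corresponding pair of discrete minimal surfaces $f,\tilde f:V^*\to\mathbb{R}^3$, and for $\theta\in[0,2\pi]$ let $f^\theta:=\cos\theta\, f+\sin\theta\,\tilde f$ be a discrete surface in the associated family, with non-vanishing vector area $\vec A:F^*_{int}\to\mathbb{R}^3\setminus\{0\}$. Define $\sigma:F^*_{int}\to\{\pm1\}$ by $$\sigma:=\langle N,\vec A/|\vec A|\rangle .$$ Then the mean curvature vector field $\vec H^\theta_\sigma:V^*_{int}\to\mathbb{R}^3$ vanishes identically, i.e. for each dual vertex $\phi^*=(v_1,v_2,\dots,v_n)^*\in V^*_{int}$ $$\vec H^\theta_{\phi^*}:=\frac12\sum_i dN(e_{i,i+1})\times df^\theta(e^*_{i,i+1})=0,$$ and furthermore $$\sum_i\langle dN(e_{i,i+1}),df^\theta(e^*_{i,i+1})\rangle=0 .$$ In particular, if $D$ is compact (a finite complex), then $f^\theta$ is a critical point of the total area $\sum\sigma|\vec A|$ (sum over $F^*_{int}$) under infinitesimal deformations with boundary fixed.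
   Context: $D=(V,E,F)$ is a cell decomposition of an oriented surface, with or without boundary; $V_{int}$, $E_{int}$ are its interior vertices and edges. $D^*=(V^*,E^*,F^* )$ is the dual: elements of $V^*$ correspond to faces of $D$ (the dual vertex of $\phi\in F$ is $\phi^*$), each $v\in V$ corresponds to a dual face $v^*$, and $F^*_{int}$ is the set of dual faces of interior vertices. $F_{int}$ is the set of faces of $D$ containing no boundary edge, and $V^*_{int}$ is the corresponding set of dual vertices. $e_{ij}$ is the oriented edge from $i$ to $j$; $e_{ij}^*$ is the dual edge oriented from the right face $\phi_r$ of $e_{ij}$ to its left face $\phi_l$. $dN(e_{ij})=N_j-N_i$ and $df(e^*_{ij})=f_{\phi_l}-f_{\phi_r}$. For a face $\phi=(v_1,\dots,v_n)$ with vertices in cyclic order, $e_{i,i+1}$ is the oriented edge from $v_i$ to $v_{i+1}$, indices mod $n$. P-graph: a cell decomposition $D$ of a simply connected surface such that every interior vertex has degree 4 and every face has an even number of edges. P-labeling: $\mu:E_{int}\to\{\pm1\}$ such that at each vertex two opposite edges are labeled $+1$ and the other two opposite edges $-1$; that is, any two interior edges that are consecutive edges of a common face (at their common vertex) have opposite labels. P-net: a realization $z:V\to\mathbb{C}$ of a P-graph with $z_i\ne z_j$ for every edge $\{ij\}$ such that for every interior vertex $v_0$ with neighbors $v_1,v_2,v_3,v_4$ in cyclic order, $\frac1{z_1-z_0}-\frac1{z_2-z_0}+\frac1{z_3-z_0}-\frac1{z_4-z_0}=0$. The inverse stereographic projection is $N:=\frac1{1+|z|^2}(2\operatorname{Re}z,2\operatorname{Im}z,|z|^2-1)$.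 The corresponding surfaces $f,\tilde f:V^*\to\mathbb{R}^3$ (unique up to translation) are those with, for every interior edge $\{ij\}$, $$df(e^*_{ij})=\mu_{ij}\frac{N_j-N_i}{|N_j-N_i|^2},\qquad d\tilde f(e^*_{ij})=N_i\times\mu_{ij}\frac{N_j-N_i}{|N_j-N_i|^2}=N_j\times\mu_{ij}\frac{N_j-N_i}{|N_j-N_i|^2}.$$ The vector area of a closed polygon $\gamma=(\gamma_0,\dots,\gamma_n=\gamma_0)$ in $\mathbb{R}^3$ is $\frac12\sum_{i=0}^{n-1}\gamma_i\times\gamma_{i+1}$; $\vec A:F^*_{int}\to\mathbb{R}^3$ assigns to a dual face $v^*$ the vector area of the polygon formed by the values of $f^\theta$ at the faces around $v$ in positive (counterclockwise) cyclic order. (It is a fact that $\vec A_{v^*}$ is parallel to $N_v$, so that $\sigma=\pm1$.) Critical point with boundary fixed: for every $\dot f:V^*\to\mathbb{R}^3$ vanishing on the boundary of the discrete surface with face set $F^*_{int}$, i.e. vanishing at every $\phi^*$ such that $\phi$ has a vertex that is not interior, the derivative at $t=0$ of $\sum_{F^*_{int}}\sigma|\vec A|$ evaluated on $f^\theta+t\dot f$ (with $\sigma$ held constant) is zero. *)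

theory Defs
  imports "HOL-Analysis.Analysis" "HOL-Combinatorics.Orbits"
begin

unbundle cross3_syntax

section \<open>Cell decompositions of oriented surfaces with boundary\<close>

(* A cell decomposition is a combinatorial map on its oriented edges: every edge {ij} gives the
   two oriented edges e_ij and e_ji, exchanged by opp.
     start e  initial vertex of e
     left e   the face to the left of e, or None if the surface does not continue there
     rot e    the next oriented edge with the same initial vertex, counterclockwise
     nxt e    the edge following e in the positively oriented boundary of its left face
              (if left e = None: the edge following e along the boundary of the surface)
   Edges are not required to be determined by their end points. *)
record ('v, 'e, 'f) cell_complex =
  verts :: "'v set"
  edges :: "'e set"
  faces :: "'f set"
  start :: "'e \<Rightarrow> 'v"
  left :: "'e \<Rightarrow> 'f option"
  opp :: "'e \<Rightarrow> 'e"
  rot :: "'e \<Rightarrow> 'e"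
  nxt :: "'e \<Rightarrow> 'e"

definition target :: "('v, 'e, 'f) cell_complex \<Rightarrow> 'e \<Rightarrow> 'v" where
  "target D e = start D (opp D e)"

definition vertex_edges :: "('v, 'e, 'f) cell_complex \<Rightarrow> 'v \<Rightarrow> 'e set" where
  "vertex_edges D v = {e \<in> edges D. start D e = v}"

(* For phi = (v_1, ..., v_n) these are the oriented edges e_{1,2}, e_{2,3}, ..., e_{n,1}. *)
definition face_edges :: "('v, 'e, 'f) cell_complex \<Rightarrow> 'f \<Rightarrow> 'e set" where
  "face_edges D \<phi> = {e \<in> edges D. left D e = Some \<phi>}"

(* cyclic_on implies finiteness and nonemptiness: vertices have finite degree, faces are finite
   polygons, but the complex itself may be infinite.  The map with None read as additional faces
   is a map without boundary; the last two conditions say that at each vertex at most one sector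
   is missing (so a neighbourhood is a disc or a half disc) and that each edge lies in the
   surface. *)
definition cell_decomposition :: "('v, 'e, 'f) cell_complex \<Rightarrow> bool" where
  "cell_decomposition D \<longleftrightarrow>
     (\<forall>e \<in> edges D. start D e \<in> verts D) \<and>
     (\<forall>e \<in> edges D. \<forall>\<phi>. left D e = Some \<phi> \<longrightarrow> \<phi> \<in> faces D) \<and>
     (\<forall>e \<in> edges D. opp D e \<in> edges D \<and> opp D e \<noteq> e \<and> opp D (opp D e) = e) \<and>
     (\<forall>v \<in> verts D. cyclic_on (rot D) (vertex_edges D v)) \<and>
     (\<forall>\<phi> \<in> faces D. cyclic_on (nxt D) (face_edges D \<phi>)) \<and>
     (\<forall>e \<in> edges D. nxt D (opp D (rot D e)) = e) \<and>
     (\<forall>e \<in> edges D. left D (nxt D e) = left D e) \<and>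
     (\<forall>e \<in> edges D. \<forall>e' \<in> edges D.
        start D e = start D e' \<and> left D e = None \<and> left D e' = None \<longrightarrow> e = e') \<and>
     (\<forall>e \<in> edges D. left D e \<noteq> None \<or> left D (opp D e) \<noteq> None)"

definition finite_complex :: "('v, 'e, 'f) cell_complex \<Rightarrow> bool" where
  "finite_complex D \<longleftrightarrow> finite (verts D) \<and> finite (edges D) \<and> finite (faces D)"

definition interior_edge :: "('v, 'e, 'f) cell_complex \<Rightarrow> 'e \<Rightarrow> bool" where
  "interior_edge D e \<longleftrightarrow> e \<in> edges D \<and> left D e \<noteq> None \<and> left D (opp D e) \<noteq> None"

definition interior_verts :: "('v, 'e, 'f) cell_complex \<Rightarrow> 'v set" where
  "interior_verts D = {v \<in> verts D. \<forall>e \<in> vertex_edges D v. left D e \<noteq> None}"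

definition interior_faces :: "('v, 'e, 'f) cell_complex \<Rightarrow> 'f set" where
  "interior_faces D = {\<phi> \<in> faces D. \<forall>e \<in> face_edges D \<phi>. interior_edge D e}"


subsection \<open>Simple connectedness\<close>

definition edge_path :: "('v, 'e, 'f) cell_complex \<Rightarrow> 'e list \<Rightarrow> bool" where
  "edge_path D p \<longleftrightarrow> set p \<subseteq> edges D \<and> successively (\<lambda>d e. target D d = start D e) p"

definition closed_edge_path :: "('v, 'e, 'f) cell_complex \<Rightarrow> 'e list \<Rightarrow> bool" where
  "closed_edge_path D p \<longleftrightarrow>
     edge_path D p \<and> (p \<noteq> [] \<longrightarrow> target D (last p) = start D (hd p))"

definition face_loop :: "('v, 'e, 'f) cell_complex \<Rightarrow> 'e \<Rightarrow> 'e list" where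
  "face_loop D e = map (\<lambda>k. (nxt D ^^ k) e) [0..<card (face_edges D (the (left D e)))]"

inductive elementary_homotopy :: "('v, 'e, 'f) cell_complex \<Rightarrow> 'e list \<Rightarrow> 'e list \<Rightarrow> bool"
  for D where
  backtrack: "e \<in> edges D \<Longrightarrow> elementary_homotopy D (p @ q) (p @ [e, opp D e] @ q)"
| around_face: "e \<in> edges D \<Longrightarrow> left D e \<noteq> None \<Longrightarrow>
    elementary_homotopy D (p @ q) (p @ face_loop D e @ q)"

definition null_homotopic :: "('v, 'e, 'f) cell_complex \<Rightarrow> 'e list \<Rightarrow> bool" where
  "null_homotopic D p \<longleftrightarrow>
     (\<lambda>q r. closed_edge_path D q \<and> closed_edge_path D r \<and>
       (elementary_homotopy D q r \<or> elementary_homotopy D r q))\<^sup>*\<^sup>* p []"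

(* The edge path group is the fundamental group of the surface. *)
definition simply_connected_complex :: "('v, 'e, 'f) cell_complex \<Rightarrow> bool" where
  "simply_connected_complex D \<longleftrightarrow>
     verts D \<noteq> {} \<and>
     (\<forall>v \<in> verts D. \<forall>w \<in> verts D. v = w \<or>
        (\<exists>p. p \<noteq> [] \<and> edge_path D p \<and> start D (hd p) = v \<and> target D (last p) = w)) \<and>
     (\<forall>p. closed_edge_path D p \<longrightarrow> null_homotopic D p)"


section \<open>P-graphs, P-labelings and P-nets\<close>

definition P_graph :: "('v, 'e, 'f) cell_complex \<Rightarrow> bool" where
  "P_graph D \<longleftrightarrow> cell_decomposition D \<and> simply_connected_complex D \<and>
     (\<forall>v \<in> interior_verts D. card (vertex_edges D v) = 4) \<and>
     (\<forall>\<phi> \<in> faces D. even (card (face_edges D \<phi>)))"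

(* A labeling of unoriented edges is a function of oriented edges invariant under opp. *)
definition P_labeling :: "('v, 'e, 'f) cell_complex \<Rightarrow> ('e \<Rightarrow> real) \<Rightarrow> bool" where
  "P_labeling D \<mu> \<longleftrightarrow>
     (\<forall>e. interior_edge D e \<longrightarrow> \<mu> e \<in> {1, -1} \<and> \<mu> (opp D e) = \<mu> e) \<and>
     (\<forall>e. interior_edge D e \<and> interior_edge D (nxt D e) \<longrightarrow> \<mu> (nxt D e) = - \<mu> e)"

definition P_net :: "('v, 'e, 'f) cell_complex \<Rightarrow> ('v \<Rightarrow> complex) \<Rightarrow> bool" where
  "P_net D z \<longleftrightarrow>
     (\<forall>e \<in> edges D. z (start D e) \<noteq> z (target D e)) \<and>
     (\<forall>v \<in> interior_verts D. \<forall>e \<in> vertex_edges D v.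
        1 / (z (target D e) - z v)
        - 1 / (z (target D (rot D e)) - z v)
        + 1 / (z (target D ((rot D ^^ 2) e)) - z v)
        - 1 / (z (target D ((rot D ^^ 3) e)) - z v) = 0)"


section \<open>Discrete minimal surfaces\<close>

definition inverse_stereographic :: "complex \<Rightarrow> real^3" where
  "inverse_stereographic z =
     (1 / (1 + (cmod z)\<^sup>2)) *\<^sub>R vector [2 * Re z, 2 * Im z, (cmod z)\<^sup>2 - 1]"

definition edge_diff :: "('v, 'e, 'f) cell_complex \<Rightarrow> ('v \<Rightarrow> real^3) \<Rightarrow> 'e \<Rightarrow> real^3" where
  "edge_diff D N e = N (target D e) - N (start D e)"

(* Functions on dual vertices are functions on faces.  The difference is meant for interior e. *)
definition dual_diff :: "('v, 'e, 'f) cell_complex \<Rightarrow> ('f \<Rightarrow> real^3) \<Rightarrow> 'e \<Rightarrow> real^3" where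
  "dual_diff D f e = f (the (left D e)) - f (the (left D (opp D e)))"

definition minimal_pair ::
  "('v, 'e, 'f) cell_complex \<Rightarrow> ('e \<Rightarrow> real) \<Rightarrow> ('v \<Rightarrow> real^3) \<Rightarrow>
   ('f \<Rightarrow> real^3) \<Rightarrow> ('f \<Rightarrow> real^3) \<Rightarrow> bool" where
  "minimal_pair D \<mu> N f f' \<longleftrightarrow>
     (\<forall>e. interior_edge D e \<longrightarrow>
        dual_diff D f e = (\<mu> e / (norm (edge_diff D N e))\<^sup>2) *\<^sub>R edge_diff D N e \<and>
        dual_diff D f' e =
          N (start D e) \<times> ((\<mu> e / (norm (edge_diff D N e))\<^sup>2) *\<^sub>R edge_diff D N e))"

(* In minimal_pair one may equally take the cross product with N at the target. *)
lemma cross3_edge_diff: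
  "N (start D e) \<times> (c *\<^sub>R edge_diff D N e) = N (target D e) \<times> (c *\<^sub>R edge_diff D N e)"
  unfolding edge_diff_def by (simp add: cross3_simps)

definition associated_surface ::
  "real \<Rightarrow> ('f \<Rightarrow> real^3) \<Rightarrow> ('f \<Rightarrow> real^3) \<Rightarrow> 'f \<Rightarrow> real^3" where
  "associated_surface \<theta> f f' \<phi> = cos \<theta> *\<^sub>R f \<phi> + sin \<theta> *\<^sub>R f' \<phi>"

(* The list [g_0, ..., g_{n-1}] represents the closed polygon (g_0, ..., g_n = g_0). *)
definition vector_area :: "(real^3) list \<Rightarrow> real^3" where
  "vector_area \<gamma> =
     (1/2) *\<^sub>R (\<Sum>i<length \<gamma>. (\<gamma> ! i) \<times> (\<gamma> ! (Suc i mod length \<gamma>)))"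

(* The vector area of the polygon does not depend on the first edge chosen here. *)
definition dual_face_polygon ::
  "('v, 'e, 'f) cell_complex \<Rightarrow> ('f \<Rightarrow> real^3) \<Rightarrow> 'v \<Rightarrow> (real^3) list" where
  "dual_face_polygon D f v =
     (let e = (SOME e. e \<in> vertex_edges D v)
      in map (\<lambda>k. f (the (left D ((rot D ^^ k) e)))) [0..<card (vertex_edges D v)])"

definition dual_face_area ::
  "('v, 'e, 'f) cell_complex \<Rightarrow> ('f \<Rightarrow> real^3) \<Rightarrow> 'v \<Rightarrow> real^3" where
  "dual_face_area D f v = vector_area (dual_face_polygon D f v)"

definition mean_curvature_vector ::
  "('v, 'e, 'f) cell_complex \<Rightarrow> ('v \<Rightarrow> real^3) \<Rightarrow> ('f \<Rightarrow> real^3) \<Rightarrow> 'f \<Rightarrow> real^3" where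
  "mean_curvature_vector D N f \<phi> =
     (1/2) *\<^sub>R (\<Sum>e \<in> face_edges D \<phi>. edge_diff D N e \<times> dual_diff D f e)"

definition total_area ::
  "('v, 'e, 'f) cell_complex \<Rightarrow> ('v \<Rightarrow> real) \<Rightarrow> ('f \<Rightarrow> real^3) \<Rightarrow> real" where
  "total_area D \<sigma> f = (\<Sum>v \<in> interior_verts D. \<sigma> v * norm (dual_face_area D f v))"

definition vanishes_on_boundary :: "('v, 'e, 'f) cell_complex \<Rightarrow> ('f \<Rightarrow> real^3) \<Rightarrow> bool" where
  "vanishes_on_boundary D g \<longleftrightarrow>
     (\<forall>\<phi> \<in> faces D. (\<exists>e \<in> face_edges D \<phi>. start D e \<notin> interior_verts D) \<longrightarrow> g \<phi> = 0)"

definition critical_for_total_area ::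
  "('v, 'e, 'f) cell_complex \<Rightarrow> ('v \<Rightarrow> real) \<Rightarrow> ('f \<Rightarrow> real^3) \<Rightarrow> bool" where
  "critical_for_total_area D \<sigma> f \<longleftrightarrow>
     (\<forall>g. vanishes_on_boundary D g \<longrightarrow>
        ((\<lambda>t. total_area D \<sigma> (\<lambda>\<phi>. f \<phi> + t *\<^sub>R g \<phi>)) has_real_derivative 0) (at 0))"

end

theory Submission
  imports Defs
begin

text \<open>
  Write \<open>d = N\<^sub>j - N\<^sub>i\<close> for an edge with label \<open>\<mu>\<close>.  Both end points of \<open>d\<close> lie on the unit sphere, so
  \<open>N\<^sub>i \<bullet> d = - |d|\<^sup>2 / 2\<close>.  Inserting this into the formula for \<open>df\<^sup>\<theta>\<close> yields
  \<open>d \<times> df\<^sup>\<theta> = (\<mu> sin \<theta> / 2) (N\<^sub>i + N\<^sub>j)\<close> and \<open>d \<bullet> df\<^sup>\<theta> = \<mu> cos \<theta>\<close>.  Along the boundary of an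
  interior face the labels alternate, so both sums over the face vanish: each vertex contributes to
  the first one with two opposite signs.

  For the variational statement, the same identity gives \<open>N\<^sub>i \<bullet> df\<^sup>\<theta> = - \<mu> cos \<theta> / 2\<close>.  The labels also
  alternate around an interior vertex, so the two diagonals of its dual quadrilateral are
  orthogonal to the normal there, and the vector area, half the cross product of the diagonals, is parallel
  to it.  The derivative of \<open>\<sigma> |A|\<close> is therefore \<open>N \<bullet> A'\<close>: the first variation of the total area
  is that of \<open>\<Sum> N \<bullet> A\<close> with \<open>N\<close> held constant.  This expression is quadratic in the surface.
  Collecting its first-order part by faces instead of by vertices (a summation by parts in the
  dual complex) turns it into \<open>\<Sum> g \<bullet> H\<close> over the faces all of whose vertices are interior, where
  \<open>g\<close> is the variation and \<open>H\<close> the mean curvature vector, which has been shown to vanish.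
\<close>

section \<open>Sums over cyclic orbits\<close>

lemma cyclic_on_bij_betw:
  assumes "cyclic_on f S"
  shows "bij_betw f S S"
proof -
  have "f ` S = S"
  proof
    show "f ` S \<subseteq> S" using assms by (auto intro: cyclic_on_inI)
    show "S \<subseteq> f ` S"
    proof
      fix x assume x: "x \<in> S"
      then have "x \<in> orbit f x" using orbit_cyclic_eq3[OF assms x] by simp
      then obtain n where "x = (f ^^ Suc n) x" by (auto simp: orbit_altdef dest: gr0_implies_Suc)
      then have "x = f ((f ^^ n) x)" by simp
      moreover have "(f ^^ n) x \<in> S" using cyclic_on_funpow_in[OF assms x] .
      ultimately show "x \<in> f ` S" by blast
    qed
  qed
  then show ?thesis
    using finite_cyclic_on[OF assms] by (simp add: bij_betw_def eq_card_imp_inj_on)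
qed

lemma sum_cyclic_shift:
  assumes "cyclic_on f S"
  shows "(\<Sum>x\<in>S. g (f x)) = (\<Sum>x\<in>S. g x)"
  using sum.reindex_bij_betw[OF cyclic_on_bij_betw[OF assms]] .

lemma sum_alternating_eq_0:
  fixes g :: "'a \<Rightarrow> 'b::real_vector"
  assumes "cyclic_on f S" and "\<And>x. x \<in> S \<Longrightarrow> g (f x) = - g x"
  shows "(\<Sum>x\<in>S. g x) = 0"
proof -
  have "(\<Sum>x\<in>S. g x) = (\<Sum>x\<in>S. - g x)"
    using sum_cyclic_shift[OF assms(1), of g] assms(2) by simp
  then have "2 *\<^sub>R (\<Sum>x\<in>S. g x) = 0" by (simp only: sum_negf scaleR_2 eq_neg_iff_add_eq_0)
  then show ?thesis by simp
qed

lemma cyclic_on_funpow: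
  assumes "cyclic_on f S" and "s \<in> S"
  shows "bij_betw (\<lambda>k. (f ^^ k) s) {..<card S} S"
    and "(f ^^ card S) s = s"
proof -
  have S: "orbit f s = S" using orbit_cyclic_eq3[OF assms] .
  then have s: "s \<in> orbit f s" using assms by simp
  let ?n = "funpow_dist1 f s s"
  have bij: "bij_betw (\<lambda>k. (f ^^ k) s) {..<?n} S"
    using inj_on_funpow_dist1[OF s] orbit_conv_funpow_dist1[OF s] S
    by (simp add: bij_betw_def atLeast0LessThan)
  then have n: "card S = ?n" using bij_betw_same_card[OF bij] by simp
  show "bij_betw (\<lambda>k. (f ^^ k) s) {..<card S} S" using bij n by simp
  show "(f ^^ card S) s = s" using funpow_dist1_prop[OF s] n by simp
qed

lemma sum_cyclic_funpow:
  assumes "cyclic_on f S" and "s \<in> S"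
  shows "(\<Sum>k<card S. g ((f ^^ k) s)) = (\<Sum>x\<in>S. g x)"
  using sum.reindex_bij_betw[OF cyclic_on_funpow(1)[OF assms]] .


section \<open>Edges around vertices and faces\<close>

context
  fixes D :: "('v, 'e, 'f) cell_complex"
  assumes cell: "cell_decomposition D"
begin

lemma opp_edge:
  assumes "e \<in> edges D"
  shows "opp D e \<in> edges D" and "opp D (opp D e) = e"
  using cell assms by (auto simp: cell_decomposition_def)

lemma start_in_verts: "e \<in> edges D \<Longrightarrow> start D e \<in> verts D"
  using cell by (auto simp: cell_decomposition_def)

lemma target_in_verts: "e \<in> edges D \<Longrightarrow> target D e \<in> verts D"
  by (simp add: target_def opp_edge start_in_verts)

lemma cyclic_rot: "v \<in> verts D \<Longrightarrow> cyclic_on (rot D) (vertex_edges D v)"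
  using cell by (simp add: cell_decomposition_def)

lemma cyclic_nxt: "\<phi> \<in> faces D \<Longrightarrow> cyclic_on (nxt D) (face_edges D \<phi>)"
  using cell by (simp add: cell_decomposition_def)

lemma rot_edge:
  assumes "e \<in> edges D"
  shows "rot D e \<in> edges D" and "start D (rot D e) = start D e"
  using cyclic_on_inI[OF cyclic_rot[OF start_in_verts[OF assms]], of e] assms
  by (auto simp: vertex_edges_def)

lemma nxt_opp_rot: "e \<in> edges D \<Longrightarrow> nxt D (opp D (rot D e)) = e"
  using cell by (simp add: cell_decomposition_def)

lemma left_opp_rot:
  assumes "e \<in> edges D"
  shows "left D (opp D (rot D e)) = left D e"
proof -
  have "left D (nxt D (opp D (rot D e))) = left D (opp D (rot D e))"
    using cell opp_edge(1)[OF rot_edge(1)[OF assms]] by (simp add: cell_decomposition_def)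
  then show ?thesis by (simp add: nxt_opp_rot assms)
qed

text \<open>
  The axiom \<open>nxt \<circ> opp \<circ> rot = id\<close> gives only a left inverse; since \<open>rot\<close> permutes the edges at each
  vertex, \<open>nxt\<close> and \<open>opp \<circ> rot\<close> are inverse to each other on both sides.
\<close>

lemma
  assumes e: "e \<in> edges D"
  shows rot_nxt: "rot D (nxt D e) = opp D e"
    and start_nxt: "start D (nxt D e) = target D e"
proof -
  let ?v = "target D e"
  have "opp D e \<in> vertex_edges D ?v"
    using e by (simp add: vertex_edges_def target_def opp_edge)
  then obtain e' where e': "e' \<in> vertex_edges D ?v" "rot D e' = opp D e"
    using cyclic_on_bij_betw[OF cyclic_rot[OF target_in_verts[OF e]]]
    by (metis bij_betw_imp_surj_on imageE)
  then have "nxt D e = e'"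
    using nxt_opp_rot[of e'] e by (simp add: vertex_edges_def opp_edge)
  then show "rot D (nxt D e) = opp D e" and "start D (nxt D e) = target D e"
    using e' by (auto simp: vertex_edges_def)
qed

lemma interior_edge_at_interior_vert:
  assumes e: "e \<in> edges D" and v: "start D e \<in> interior_verts D"
  shows "interior_edge D e"
proof -
  have all: "left D x \<noteq> None" if "x \<in> vertex_edges D (start D e)" for x
    using v that by (simp add: interior_verts_def)
  have "e \<in> vertex_edges D (start D e)" using e by (simp add: vertex_edges_def)
  then obtain e' where e': "e' \<in> vertex_edges D (start D e)" "rot D e' = e"
    using cyclic_on_bij_betw[OF cyclic_rot[OF start_in_verts[OF e]]]
    by (metis bij_betw_imp_surj_on imageE)
  then have "left D (opp D e) = left D e'"
    using left_opp_rot[of e'] by (auto simp: vertex_edges_def)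
  then show ?thesis
    using e e' all[of e] all[of e'] by (auto simp: interior_edge_def vertex_edges_def)
qed

text \<open>
  Consecutive edges at an interior vertex are consecutive edges of the face between them, which is
  how the labeling condition along faces passes to vertices.
\<close>

lemma label_rot:
  assumes "P_labeling D \<mu>" and e: "e \<in> edges D" and v: "start D e \<in> interior_verts D"
  shows "\<mu> (rot D e) = - \<mu> e"
proof -
  have ie: "interior_edge D e" using interior_edge_at_interior_vert[OF e v] .
  have ir: "interior_edge D (rot D e)"
    using interior_edge_at_interior_vert[of "rot D e"] e v by (simp add: rot_edge)
  then have io: "interior_edge D (opp D (rot D e))"
    by (auto simp: interior_edge_def opp_edge)
  have "\<mu> (nxt D (opp D (rot D e))) = - \<mu> (opp D (rot D e))"
    using assms(1) io ie nxt_opp_rot[OF e] by (metis P_labeling_def)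
  moreover have "\<mu> (opp D (rot D e)) = \<mu> (rot D e)"
    using assms(1) ir by (simp add: P_labeling_def)
  ultimately show ?thesis using nxt_opp_rot[OF e] by simp
qed

lemma dual_diff_opp:
  "e \<in> edges D \<Longrightarrow> dual_diff D f (opp D e) = - dual_diff D f e"
  by (simp add: dual_diff_def opp_edge)

lemma dual_diff_rot:
  "e \<in> edges D \<Longrightarrow> dual_diff D f (rot D e) = f (the (left D (rot D e))) - f (the (left D e))"
  by (simp add: dual_diff_def left_opp_rot)

lemma dual_face_area_eq_sum:
  assumes v: "v \<in> verts D"
  shows "dual_face_area D f v =
    (1/2) *\<^sub>R (\<Sum>e\<in>vertex_edges D v. f (the (left D e)) \<times> f (the (left D (rot D e))))"
proof -
  let ?S = "vertex_edges D v"
  have cyc: "cyclic_on (rot D) ?S" using cyclic_rot[OF v] .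
  define e0 where "e0 = (SOME e. e \<in> ?S)"
  have e0: "e0 \<in> ?S"
    using cyc unfolding e0_def by (auto simp: cyclic_on_alldef some_in_eq)
  let ?F = "\<lambda>k. f (the (left D ((rot D ^^ k) e0)))"
  have period: "?F (Suc k mod card ?S) = ?F (Suc k)" if "k < card ?S" for k
  proof (cases "Suc k = card ?S")
    case True
    then show ?thesis using cyclic_on_funpow(2)[OF cyc e0] by (simp only: True mod_self funpow_0)
  next
    case False
    then show ?thesis using that by simp
  qed
  have "dual_face_area D f v = vector_area (map ?F [0..<card ?S])"
    by (simp add: dual_face_area_def dual_face_polygon_def Let_def e0_def)
  also have "\<dots> = (1/2) *\<^sub>R (\<Sum>k<card ?S. ?F k \<times> ?F (Suc k mod card ?S))"
    unfolding vector_area_def by (auto intro!: sum.cong)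
  also have "\<dots> = (1/2) *\<^sub>R (\<Sum>k<card ?S. ?F k \<times> ?F (Suc k))"
    by (intro arg_cong[where f = "\<lambda>x. (1/2) *\<^sub>R x"] sum.cong refl) (simp only: period lessThan_iff)
  also have "(\<Sum>k<card ?S. ?F k \<times> ?F (Suc k)) =
      (\<Sum>e\<in>?S. f (the (left D e)) \<times> f (the (left D (rot D e))))"
    using sum_cyclic_funpow[OF cyc e0,
        of "\<lambda>e. f (the (left D e)) \<times> f (the (left D (rot D e)))"] by simp
  finally show ?thesis .
qed

text \<open>
  In terms of the diagonals, the area of a quadrilateral depends only on sums of two consecutive
  dual edges.  In the normal component of such a sum, alternating labels cancel.
\<close>

lemma dual_face_area_quadrilateral:
  assumes v: "v \<in> verts D" and deg: "card (vertex_edges D v) = 4" and e: "e \<in> vertex_edges D v"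
  shows "dual_face_area D f v = (1/2) *\<^sub>R
    ((dual_diff D f (rot D e) + dual_diff D f (rot D (rot D e))) \<times>
     (dual_diff D f (rot D (rot D e)) + dual_diff D f (rot D (rot D (rot D e)))))"
proof -
  let ?F = "\<lambda>e. f (the (left D e))"
  let ?r = "rot D"
  have cyc: "cyclic_on ?r (vertex_edges D v)" using cyclic_rot[OF v] .
  have r4: "?r (?r (?r (?r e))) = e"
    using cyclic_on_funpow(2)[OF cyc e] unfolding deg by (simp add: numeral_eq_Suc)
  have "dual_face_area D f v = (1/2) *\<^sub>R (\<Sum>k<4. ?F ((?r ^^ k) e) \<times> ?F (?r ((?r ^^ k) e)))"
    using dual_face_area_eq_sum[OF v, of f]
      sum_cyclic_funpow[OF cyc e, of "\<lambda>e. ?F e \<times> ?F (?r e)", unfolded deg] by simp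
  also have "\<dots> = (1/2) *\<^sub>R (?F e \<times> ?F (?r e) + ?F (?r e) \<times> ?F (?r (?r e))
      + ?F (?r (?r e)) \<times> ?F (?r (?r (?r e))) + ?F (?r (?r (?r e))) \<times> ?F e)"
    by (simp add: numeral_eq_Suc r4)
  also have "\<dots> = (1/2) *\<^sub>R
      ((?F (?r (?r e)) - ?F e) \<times> (?F (?r (?r (?r e))) - ?F (?r e)))"
  proof -
    have "a \<times> b + b \<times> c + c \<times> d + d \<times> a = (c - a) \<times> (d - b)" for a b c d :: "real^3"
      by (simp add: Cross3.left_diff_distrib Cross3.right_diff_distrib
          cross_skew[of c b] cross_skew[of a d])
    then show ?thesis by simp
  qed
  finally show ?thesis
    using e by (simp add: vertex_edges_def dual_diff_rot rot_edge)
qed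


section \<open>The first variation of the vector area\<close>

definition area_variation :: "('f \<Rightarrow> real^3) \<Rightarrow> ('f \<Rightarrow> real^3) \<Rightarrow> 'v \<Rightarrow> real^3" where
  "area_variation f g v = (1/2) *\<^sub>R (\<Sum>e\<in>vertex_edges D v.
     g (the (left D e)) \<times> f (the (left D (rot D e))) +
     f (the (left D e)) \<times> g (the (left D (rot D e))))"

lemma dual_face_area_perturbed:
  assumes "v \<in> verts D"
  shows "dual_face_area D (\<lambda>\<phi>. f \<phi> + t *\<^sub>R g \<phi>) v =
    dual_face_area D f v + t *\<^sub>R area_variation f g v + t\<^sup>2 *\<^sub>R dual_face_area D g v"
  unfolding dual_face_area_eq_sum[OF assms] area_variation_def
  by (simp add: cross_add_left cross_add_right cross_mult_left cross_mult_right
      sum.distrib scaleR_add_right scaleR_right.sum power2_eq_square algebra_simps)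

text \<open>
  Moving a corner of a polygon changes its vector area by half the cross product of the
  displacement with the diagonal past the corner, here the sum of the two adjacent dual edges.
\<close>

lemma inner_area_variation:
  assumes v: "v \<in> verts D"
  shows "n \<bullet> area_variation f g v = (1/2) * (\<Sum>e\<in>vertex_edges D v.
    n \<bullet> (g (the (left D e)) \<times> (dual_diff D f e + dual_diff D f (rot D e))))"
proof -
  let ?S = "vertex_edges D v"
  let ?r = "rot D"
  let ?F = "\<lambda>e. f (the (left D e))" and ?G = "\<lambda>e. g (the (left D e))" and ?d = "dual_diff D f"
  have cyc: "cyclic_on ?r ?S" using cyclic_rot[OF v] .
  have split: "?G e \<times> ?F (?r e) + ?F e \<times> ?G (?r e) =
      ?G e \<times> ?d (?r e) + ?G (?r e) \<times> ?d (?r e) + (?G e \<times> ?F e - ?G (?r e) \<times> ?F (?r e))"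
    if "e \<in> ?S" for e
  proof -
    have "?d (?r e) = ?F (?r e) - ?F e"
      using that by (simp add: vertex_edges_def dual_diff_rot)
    then show ?thesis
      by (simp add: Cross3.right_diff_distrib cross_skew[of "?F e" "?G (?r e)"])
  qed
  have "(\<Sum>e\<in>?S. ?G e \<times> ?F (?r e) + ?F e \<times> ?G (?r e)) =
      (\<Sum>e\<in>?S. ?G e \<times> ?d (?r e)) + (\<Sum>e\<in>?S. ?G (?r e) \<times> ?d (?r e))
      + ((\<Sum>e\<in>?S. ?G e \<times> ?F e) - (\<Sum>e\<in>?S. ?G (?r e) \<times> ?F (?r e)))"
    using split by (simp add: sum.distrib sum_subtractf)
  also have "\<dots> = (\<Sum>e\<in>?S. ?G e \<times> (?d e + ?d (?r e)))"
    using sum_cyclic_shift[OF cyc, of "\<lambda>e. ?G e \<times> ?d e"]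
      sum_cyclic_shift[OF cyc, of "\<lambda>e. ?G e \<times> ?F e"]
    by (simp add: sum.distrib cross_add_right)
  finally show ?thesis
    by (simp add: area_variation_def inner_sum_right)
qed

text \<open>
  The contributions of one face to the variation.  In the terms containing \<open>rot e\<close>, passing to the
  next edge of the face replaces \<open>rot e\<close> by \<open>opp e\<close> and the start of \<open>e\<close> by its target, so the
  normals combine to their difference along \<open>e\<close>.
\<close>

lemma face_variation_eq_mean_curvature:
  assumes \<phi>: "\<phi> \<in> faces D"
  shows "(\<Sum>e\<in>face_edges D \<phi>.
      N (start D e) \<bullet> (u \<times> (dual_diff D f e + dual_diff D f (rot D e)))) =
    2 * (u \<bullet> mean_curvature_vector D N f \<phi>)"
proof -
  let ?S = "face_edges D \<phi>" and ?d = "dual_diff D f"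
  have cyc: "cyclic_on (nxt D) ?S" using cyclic_nxt[OF \<phi>] .
  have "(\<Sum>e\<in>?S. N (start D e) \<bullet> (u \<times> ?d (rot D e))) =
      (\<Sum>e\<in>?S. N (start D (nxt D e)) \<bullet> (u \<times> ?d (rot D (nxt D e))))"
    using sum_cyclic_shift[OF cyc, of "\<lambda>e. N (start D e) \<bullet> (u \<times> ?d (rot D e))"] by simp
  also have "\<dots> = (\<Sum>e\<in>?S. - (N (target D e) \<bullet> (u \<times> ?d e)))"
    by (intro sum.cong) (auto simp: face_edges_def start_nxt rot_nxt dual_diff_opp)
  finally have "(\<Sum>e\<in>?S. N (start D e) \<bullet> (u \<times> (?d e + ?d (rot D e)))) =
      (\<Sum>e\<in>?S. - (edge_diff D N e \<bullet> (u \<times> ?d e)))"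
    by (simp add: cross_add_right inner_add_right sum.distrib sum_negf edge_diff_def
        inner_diff_left sum_subtractf)
  also have "\<dots> = (\<Sum>e\<in>?S. u \<bullet> (edge_diff D N e \<times> ?d e))"
  proof -
    have "- (a \<bullet> (u \<times> b)) = u \<bullet> (a \<times> b)" for a b
      by (metis cross_skew cross_triple inner_commute inner_minus_right)
    then show ?thesis by simp
  qed
  finally show ?thesis by (simp add: mean_curvature_vector_def inner_sum_right)
qed

text \<open>
  A face all of whose vertices are interior has only interior edges, so the hypothesis on
  interior faces reaches every face on which the variation is nonzero.
\<close>

lemma sum_area_variation_eq_0:
  assumes fin: "finite_complex D"
    and H: "\<And>\<phi>. \<phi> \<in> interior_faces D \<Longrightarrow> mean_curvature_vector D N f \<phi> = 0"
    and g: "vanishes_on_boundary D g"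
  shows "(\<Sum>v\<in>interior_verts D. N v \<bullet> area_variation f g v) = 0"
proof -
  let ?I = "interior_verts D"
  let ?S = "{e \<in> edges D. start D e \<in> ?I}"
  define h where "h e =
    N (start D e) \<bullet> (g (the (left D e)) \<times> (dual_diff D f e + dual_diff D f (rot D e)))" for e
  have fins: "finite ?S" "finite ?I" "finite (faces D)"
    using fin by (auto simp: finite_complex_def interior_verts_def)
  have left_S: "left D e = Some (the (left D e)) \<and> the (left D e) \<in> faces D" if "e \<in> ?S" for e
  proof -
    have "left D e \<noteq> None"
      using interior_edge_at_interior_vert[of e] that by (simp add: interior_edge_def)
    then show ?thesis using cell that by (auto simp: cell_decomposition_def)
  qed
  have face: "(\<Sum>e\<in>{e\<in>?S. the (left D e) = \<phi>}. h e) = 0" if \<phi>: "\<phi> \<in> faces D" for \<phi>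
  proof (cases "\<exists>e\<in>face_edges D \<phi>. start D e \<notin> ?I")
    case True
    then have "g \<phi> = 0" using g \<phi> by (auto simp: vanishes_on_boundary_def)
    then show ?thesis by (simp add: h_def)
  next
    case False
    then have "\<phi> \<in> interior_faces D"
      using \<phi> interior_edge_at_interior_vert by (auto simp: interior_faces_def face_edges_def)
    moreover have "{e\<in>?S. the (left D e) = \<phi>} = face_edges D \<phi>"
      using False left_S by (auto simp: face_edges_def)
    moreover have "(\<Sum>e\<in>face_edges D \<phi>. h e) = 2 * (g \<phi> \<bullet> mean_curvature_vector D N f \<phi>)"
      unfolding face_variation_eq_mean_curvature[OF \<phi>, symmetric]
      by (intro sum.cong) (auto simp: h_def face_edges_def)
    ultimately show ?thesis by (simp add: H)
  qed
  have "(\<Sum>v\<in>?I. N v \<bullet> area_variation f g v) = (\<Sum>v\<in>?I. (1/2) * (\<Sum>e\<in>{e\<in>?S. start D e = v}. h e))"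
  proof (intro sum.cong refl)
    fix v assume v: "v \<in> ?I"
    then have "{e\<in>?S. start D e = v} = vertex_edges D v" by (auto simp: vertex_edges_def)
    moreover have "(\<Sum>e\<in>vertex_edges D v. h e) = (\<Sum>e\<in>vertex_edges D v.
        N v \<bullet> (g (the (left D e)) \<times> (dual_diff D f e + dual_diff D f (rot D e))))"
      by (intro sum.cong) (auto simp: h_def vertex_edges_def)
    ultimately show "N v \<bullet> area_variation f g v = (1/2) * (\<Sum>e\<in>{e\<in>?S. start D e = v}. h e)"
      using inner_area_variation[of v "N v" f g] v by (simp add: interior_verts_def)
  qed
  also have "\<dots> = (1/2) * (\<Sum>e\<in>?S. h e)"
    unfolding sum_distrib_left[symmetric]
    using sum.group[OF fins(1,2), of "start D" h] by (simp add: image_subset_iff)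
  also have "(\<Sum>e\<in>?S. h e) = (\<Sum>\<phi>\<in>faces D. \<Sum>e\<in>{e\<in>?S. the (left D e) = \<phi>}. h e)"
    using sum.group[OF fins(1,3), of "\<lambda>e. the (left D e)" h] left_S
    by (simp add: image_subset_iff)
  also have "\<dots> = 0" using face by simp
  finally show ?thesis by simp
qed

text \<open>
  Where the vector area is parallel to a unit vector \<open>n\<close>, the sign \<open>\<sigma>\<close> turns \<open>A / |A|\<close> into \<open>n\<close>, and
  \<open>\<sigma> |A|\<close> varies to first order like \<open>n \<bullet> A\<close>.
\<close>

lemma signed_area_has_derivative:
  assumes v: "v \<in> verts D"
    and n: "norm n = 1" and par: "dual_face_area D f v = c *\<^sub>R n"
    and nz: "dual_face_area D f v \<noteq> 0"
    and s: "s = n \<bullet> (dual_face_area D f v /\<^sub>R norm (dual_face_area D f v))"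
  shows "((\<lambda>t. s * norm (dual_face_area D (\<lambda>\<phi>. f \<phi> + t *\<^sub>R g \<phi>) v))
    has_real_derivative n \<bullet> area_variation f g v) (at 0)"
proof -
  let ?A = "dual_face_area D f v" and ?B = "area_variation f g v" and ?C = "dual_face_area D g v"
  have c: "c \<noteq> 0" using nz par by auto
  have nn: "n \<bullet> n = 1" using n by (simp add: norm_eq_1)
  have s': "s = sgn c"
    using s n by (simp add: par nn divide_inverse[symmetric] sgn_if mult.commute)
  have "((\<lambda>t. ?A + t *\<^sub>R ?B + t\<^sup>2 *\<^sub>R ?C) has_derivative (\<lambda>t. t *\<^sub>R ?B)) (at 0)"
    by (auto intro!: derivative_eq_intros)
  moreover have "(norm has_derivative (\<lambda>h. h \<bullet> sgn ?A)) (at (?A + 0 *\<^sub>R ?B + 0\<^sup>2 *\<^sub>R ?C))"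
    using has_derivative_norm[OF nz] by simp
  ultimately have "((\<lambda>t. norm (?A + t *\<^sub>R ?B + t\<^sup>2 *\<^sub>R ?C)) has_derivative
      (\<lambda>t. (t *\<^sub>R ?B) \<bullet> sgn ?A)) (at 0)"
    by (rule has_derivative_compose)
  then have "((\<lambda>t. norm (?A + t *\<^sub>R ?B + t\<^sup>2 *\<^sub>R ?C)) has_real_derivative ?B \<bullet> sgn ?A) (at 0)"
    by (simp add: has_field_derivative_def mult_commute_abs)
  then have "((\<lambda>t. s * norm (?A + t *\<^sub>R ?B + t\<^sup>2 *\<^sub>R ?C))
      has_real_derivative s * (?B \<bullet> sgn ?A)) (at 0)"
    by (rule DERIV_cmult)
  moreover have "s * (?B \<bullet> sgn ?A) = n \<bullet> ?B"
    using n c by (simp add: s' par sgn_scaleR sgn_div_norm[of n] inner_commute sgn_if)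
  ultimately show ?thesis by (simp add: dual_face_area_perturbed[OF v])
qed

end


section \<open>Chords of the unit sphere\<close>

lemma
  fixes z w :: complex
  shows norm_inverse_stereographic: "norm (inverse_stereographic z) = 1"
    and inverse_stereographic_eq_iff:
      "inverse_stereographic z = inverse_stereographic w \<longleftrightarrow> z = w"
proof -
  let ?r = "\<lambda>z. (cmod z)\<^sup>2"
  have pos: "1 + ?r z > 0" for z
    by (simp add: add_pos_nonneg)
  have comp: "inverse_stereographic z $ 1 = 2 * Re z / (1 + ?r z)"
    "inverse_stereographic z $ 2 = 2 * Im z / (1 + ?r z)"
    "inverse_stereographic z $ 3 = (?r z - 1) / (1 + ?r z)" for z
    by (simp_all add: inverse_stereographic_def)
  have "inverse_stereographic z \<bullet> inverse_stereographic z =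
      ((2 * Re z)\<^sup>2 + (2 * Im z)\<^sup>2 + (?r z - 1)\<^sup>2) / (1 + ?r z)\<^sup>2"
    by (simp add: inner_vec_def sum_3 comp power2_eq_square add_divide_distrib)
  also have "(2 * Re z)\<^sup>2 + (2 * Im z)\<^sup>2 + (?r z - 1)\<^sup>2 = (1 + ?r z)\<^sup>2"
    unfolding cmod_power2 by (simp add: power2_eq_square algebra_simps)
  finally show "norm (inverse_stereographic z) = 1"
    using pos[of z] by (simp add: norm_eq_1)
  show "inverse_stereographic z = inverse_stereographic w \<longleftrightarrow> z = w"
  proof
    assume eq: "inverse_stereographic z = inverse_stereographic w"
    \<comment> \<open>The height determines the modulus, hence the common denominator.\<close>
    have "(?r z - 1) / (1 + ?r z) = (?r w - 1) / (1 + ?r w)"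
      using eq comp(3) by metis
    then have r: "?r z = ?r w"
      using pos[of z] pos[of w] by (simp add: field_simps)
    have "2 * Re z / (1 + ?r z) = 2 * Re w / (1 + ?r w)"
      "2 * Im z / (1 + ?r z) = 2 * Im w / (1 + ?r w)"
      using eq comp(1,2) by metis+
    then show "z = w" using pos[of w] by (simp add: r complex_eq_iff)
  qed simp
qed

text \<open>
  The three products with \<open>df\<^sup>\<theta>\<close> that the proof rests on.  All of them come from
  \<open>a \<bullet> (b - a) = - |b - a|\<^sup>2 / 2\<close>, which says that the inversion \<open>d / |d|\<^sup>2\<close> of the sphere about its
  point \<open>a\<close> lies in a plane orthogonal to \<open>a\<close>.
\<close>

lemma chord_products:
  fixes a b :: "real^3" and m \<theta> :: real
  defines "d \<equiv> b - a"
  defines "w \<equiv> cos \<theta> *\<^sub>R ((m / (norm d)\<^sup>2) *\<^sub>R d) + sin \<theta> *\<^sub>R (a \<times> ((m / (norm d)\<^sup>2) *\<^sub>R d))"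
  assumes a: "norm a = 1" and b: "norm b = 1" and ab: "a \<noteq> b"
  shows "d \<times> w = (sin \<theta> * m / 2) *\<^sub>R (a + b)"
    and "d \<bullet> w = cos \<theta> * m"
    and "a \<bullet> w = - (cos \<theta> * m / 2)"
proof -
  have aa: "a \<bullet> a = 1" and bb: "b \<bullet> b = 1" using a b by (simp_all add: norm_eq_1)
  have dd: "d \<bullet> d = (norm d)\<^sup>2" by (simp add: power2_norm_eq_inner)
  have nz: "(norm d)\<^sup>2 \<noteq> 0" using ab by (simp add: d_def)
  have "(norm d)\<^sup>2 = 2 - 2 * (a \<bullet> b)"
    unfolding dd[symmetric] unfolding d_def
    by (simp add: inner_diff_left inner_diff_right aa bb inner_commute)
  then have ad: "a \<bullet> d = - (norm d)\<^sup>2 / 2"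
    by (simp add: d_def inner_diff_right aa)
  have "d \<times> (a \<times> d) = (norm d)\<^sup>2 *\<^sub>R a + ((norm d)\<^sup>2 / 2) *\<^sub>R d"
    by (simp add: Lagrange dd ad inner_commute[of d a])
  also have "\<dots> = ((norm d)\<^sup>2 / 2) *\<^sub>R (2 *\<^sub>R a + d)"
    by (simp add: scaleR_add_right)
  also have "2 *\<^sub>R a + d = a + b" by (simp add: d_def scaleR_2)
  finally have dad: "d \<times> (a \<times> d) = ((norm d)\<^sup>2 / 2) *\<^sub>R (a + b)" .
  show "d \<times> w = (sin \<theta> * m / 2) *\<^sub>R (a + b)"
    using nz by (simp add: w_def cross_add_right cross_mult_right dad del: scaleR_add_right)
  show "d \<bullet> w = cos \<theta> * m"
    using nz by (simp add: w_def inner_add_right cross_mult_right dd dot_cross_self)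
  show "a \<bullet> w = - (cos \<theta> * m / 2)"
    using nz by (simp add: w_def inner_add_right cross_mult_right ad dot_cross_self)
qed

lemma cross_orthogonal_parallel:
  fixes n x y :: "real^3"
  assumes "norm n = 1" and "n \<bullet> x = 0" and "n \<bullet> y = 0"
  shows "x \<times> y = (n \<bullet> (x \<times> y)) *\<^sub>R n"
proof -
  have "n \<times> (x \<times> y) = 0" using assms(2,3) by (simp add: Lagrange)
  then have "(n \<bullet> (x \<times> y)) *\<^sub>R n - (n \<bullet> n) *\<^sub>R (x \<times> y) = 0"
    using Lagrange[of n n "x \<times> y"] by simp
  then show ?thesis using assms(1) by (simp add: norm_eq_1)
qed


section \<open>Surfaces of the associated family\<close>

text \<open>
  What remains of \<open>df\<^sup>\<theta>\<close> after the chord identities: each product depends on the edge only through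
  its label and the normals at its ends, so that alternation of the labels leads to cancellation.
\<close>

definition associated_differential ::
  "('v, 'e, 'f) cell_complex \<Rightarrow> ('e \<Rightarrow> real) \<Rightarrow> ('v \<Rightarrow> real^3) \<Rightarrow> real \<Rightarrow> ('f \<Rightarrow> real^3) \<Rightarrow> bool" where
  "associated_differential D \<mu> N \<theta> f \<longleftrightarrow>
     (\<forall>e. interior_edge D e \<longrightarrow>
        edge_diff D N e \<times> dual_diff D f e =
          (sin \<theta> * \<mu> e / 2) *\<^sub>R (N (start D e) + N (target D e)) \<and>
        edge_diff D N e \<bullet> dual_diff D f e = cos \<theta> * \<mu> e \<and>
        N (start D e) \<bullet> dual_diff D f e = - (cos \<theta> * \<mu> e / 2))"

lemma associated_surface_differential:
  assumes "minimal_pair D \<mu> N f f'"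
    and "\<And>e. interior_edge D e \<Longrightarrow>
      norm (N (start D e)) = 1 \<and> norm (N (target D e)) = 1 \<and> N (start D e) \<noteq> N (target D e)"
  shows "associated_differential D \<mu> N \<theta> (associated_surface \<theta> f f')"
  unfolding associated_differential_def
proof (intro allI impI)
  fix e assume e: "interior_edge D e"
  have "dual_diff D (associated_surface \<theta> f f') e =
      cos \<theta> *\<^sub>R dual_diff D f e + sin \<theta> *\<^sub>R dual_diff D f' e"
    by (simp add: dual_diff_def associated_surface_def algebra_simps)
  also have "\<dots> = cos \<theta> *\<^sub>R ((\<mu> e / (norm (edge_diff D N e))\<^sup>2) *\<^sub>R edge_diff D N e) +
      sin \<theta> *\<^sub>R (N (start D e) \<times> ((\<mu> e / (norm (edge_diff D N e))\<^sup>2) *\<^sub>R edge_diff D N e))"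
    using assms(1) e by (simp add: minimal_pair_def)
  finally have eq: "dual_diff D (associated_surface \<theta> f f') e = \<dots>" .
  show "edge_diff D N e \<times> dual_diff D (associated_surface \<theta> f f') e =
          (sin \<theta> * \<mu> e / 2) *\<^sub>R (N (start D e) + N (target D e)) \<and>
        edge_diff D N e \<bullet> dual_diff D (associated_surface \<theta> f f') e = cos \<theta> * \<mu> e \<and>
        N (start D e) \<bullet> dual_diff D (associated_surface \<theta> f f') e = - (cos \<theta> * \<mu> e / 2)"
    unfolding eq edge_diff_def
    using chord_products[of "N (start D e)" "N (target D e)" \<theta> "\<mu> e"] assms(2)[OF e] by blast
qed

lemma mean_curvature_eq_0:
  assumes cell: "cell_decomposition D" and lab: "P_labeling D \<mu>"
    and ad: "associated_differential D \<mu> N \<theta> f" and \<phi>: "\<phi> \<in> interior_faces D"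
  shows "mean_curvature_vector D N f \<phi> = 0"
    and "(\<Sum>e \<in> face_edges D \<phi>. edge_diff D N e \<bullet> dual_diff D f e) = 0"
proof -
  let ?S = "face_edges D \<phi>"
  have cyc: "cyclic_on (nxt D) ?S"
    using cyclic_nxt[OF cell] \<phi> by (simp add: interior_faces_def)
  have int: "interior_edge D e" if "e \<in> ?S" for e
    using \<phi> that by (simp add: interior_faces_def)
  have alt: "\<mu> (nxt D e) = - \<mu> e" if "e \<in> ?S" for e
    using lab int[OF that] int[OF cyclic_on_inI[OF cyc that]] by (simp add: P_labeling_def)
  have start_nxt_S: "start D (nxt D e) = target D e" if "e \<in> ?S" for e
    using start_nxt[OF cell] that by (simp add: face_edges_def)
  \<comment> \<open>The label of the edge after a vertex is opposite to that of the edge before it.\<close>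
  have "(\<Sum>e\<in>?S. \<mu> e *\<^sub>R N (start D e)) = (\<Sum>e\<in>?S. \<mu> (nxt D e) *\<^sub>R N (start D (nxt D e)))"
    using sum_cyclic_shift[OF cyc, of "\<lambda>e. \<mu> e *\<^sub>R N (start D e)"] by simp
  also have "\<dots> = - (\<Sum>e\<in>?S. \<mu> e *\<^sub>R N (target D e))"
    by (simp add: alt start_nxt_S sum_negf)
  finally have tel: "(\<Sum>e\<in>?S. \<mu> e *\<^sub>R (N (start D e) + N (target D e))) = 0"
    by (simp add: scaleR_add_right sum.distrib)
  have "(\<Sum>e\<in>?S. edge_diff D N e \<times> dual_diff D f e) =
      (\<Sum>e\<in>?S. (sin \<theta> / 2) *\<^sub>R (\<mu> e *\<^sub>R (N (start D e) + N (target D e))))"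
    using ad int by (intro sum.cong) (auto simp: associated_differential_def)
  also have "\<dots> = 0" by (simp only: scaleR_right.sum[symmetric] tel scaleR_zero_right)
  finally show "mean_curvature_vector D N f \<phi> = 0"
    by (simp add: mean_curvature_vector_def)
  have "(\<Sum>e\<in>?S. edge_diff D N e \<bullet> dual_diff D f e) = (\<Sum>e\<in>?S. cos \<theta> * \<mu> e)"
    using ad int by (intro sum.cong) (auto simp: associated_differential_def)
  also have "\<dots> = 0"
    by (rule sum_alternating_eq_0[OF cyc]) (simp add: alt)
  finally show "(\<Sum>e\<in>?S. edge_diff D N e \<bullet> dual_diff D f e) = 0" .
qed

text \<open>
  The dual edges at \<open>v\<close> have the alternating normal components \<open>\<plusminus> cos \<theta> / 2\<close>, so those of any two
  consecutive ones cancel, and both diagonals of the dual quadrilateral are orthogonal to \<open>N v\<close>.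
\<close>

lemma dual_face_area_parallel_normal:
  assumes cell: "cell_decomposition D" and lab: "P_labeling D \<mu>"
    and ad: "associated_differential D \<mu> N \<theta> f"
    and v: "v \<in> interior_verts D" and deg: "card (vertex_edges D v) = 4"
    and n: "norm (N v) = 1"
  obtains c where "dual_face_area D f v = c *\<^sub>R N v"
proof -
  have vv: "v \<in> verts D" using v by (simp add: interior_verts_def)
  have at_v: "rot D e \<in> vertex_edges D v" if "e \<in> vertex_edges D v" for e
    using cyclic_on_inI[OF cyclic_rot[OF cell vv] that] .
  have diag: "N v \<bullet> (dual_diff D f e + dual_diff D f (rot D e)) = 0"
    if e: "e \<in> vertex_edges D v" for e
  proof -
    have "N v \<bullet> dual_diff D f x = - (cos \<theta> * \<mu> x / 2)" if "x \<in> vertex_edges D v" for x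
      using ad interior_edge_at_interior_vert[OF cell, of x] that v
      by (auto simp: associated_differential_def vertex_edges_def)
    then show ?thesis
      using e at_v[OF e] label_rot[OF cell lab, of e] v
      by (simp add: inner_add_right vertex_edges_def)
  qed
  obtain e where e: "e \<in> vertex_edges D v"
    using deg by fastforce
  let ?x = "dual_diff D f (rot D e) + dual_diff D f (rot D (rot D e))"
  let ?y = "dual_diff D f (rot D (rot D e)) + dual_diff D f (rot D (rot D (rot D e)))"
  have "?x \<times> ?y = (N v \<bullet> (?x \<times> ?y)) *\<^sub>R N v" (is "_ = ?c *\<^sub>R _")
    using cross_orthogonal_parallel[OF n diag diag] at_v e by blast
  then have "(1/2) *\<^sub>R (?x \<times> ?y) = (1/2) *\<^sub>R (?c *\<^sub>R N v)" by (rule arg_cong)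
  then have "dual_face_area D f v = (1/2 * ?c) *\<^sub>R N v"
    unfolding dual_face_area_quadrilateral[OF cell vv deg e, of f] scaleR_scaleR .
  then show ?thesis by (rule that)
qed

theorem theorem7p2p2:
  fixes D :: "('v, 'e, 'f) cell_complex"
    and \<mu> :: "'e \<Rightarrow> real"
    and z :: "'v \<Rightarrow> complex"
    and N :: "'v \<Rightarrow> real^3"
    and f f' f\<theta> :: "'f \<Rightarrow> real^3"
    and \<theta> :: real
    and \<sigma> :: "'v \<Rightarrow> real"
  assumes "P_graph D"
    and "P_labeling D \<mu>"
    and "P_net D z"
    and "\<forall>v \<in> verts D. N v = inverse_stereographic (z v)"
    and "minimal_pair D \<mu> N f f'"
    and "\<theta> \<in> {0..2 * pi}"
    and "f\<theta> = associated_surface \<theta> f f'"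
    and "\<forall>v \<in> interior_verts D. dual_face_area D f\<theta> v \<noteq> 0"
    and "\<forall>v \<in> interior_verts D.
           \<sigma> v = N v \<bullet> (dual_face_area D f\<theta> v /\<^sub>R norm (dual_face_area D f\<theta> v))"
  shows "(\<forall>\<phi> \<in> interior_faces D.
            mean_curvature_vector D N f\<theta> \<phi> = 0 \<and>
            (\<Sum>e \<in> face_edges D \<phi>. edge_diff D N e \<bullet> dual_diff D f\<theta> e) = 0) \<and>
         (finite_complex D \<longrightarrow> critical_for_total_area D \<sigma> f\<theta>)"
proof -
  have deg: "card (vertex_edges D v) = 4" if "v \<in> interior_verts D" for v
    using assms(1) that by (auto simp: P_graph_def)
  have cell: "cell_decomposition D" using assms(1) by (simp add: P_graph_def)
  have unit: "norm (N v) = 1" if "v \<in> verts D" for v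
    using assms(4) that by (simp add: norm_inverse_stereographic)
  have ad: "associated_differential D \<mu> N \<theta> f\<theta>"
    unfolding assms(7)
  proof (rule associated_surface_differential[OF assms(5)])
    fix e assume "interior_edge D e"
    then have e: "e \<in> edges D" by (simp add: interior_edge_def)
    then have "z (start D e) \<noteq> z (target D e)" using assms(3) by (simp add: P_net_def)
    then show "norm (N (start D e)) = 1 \<and> norm (N (target D e)) = 1 \<and>
        N (start D e) \<noteq> N (target D e)"
      using e assms(4) unit start_in_verts[OF cell] target_in_verts[OF cell]
      by (simp add: inverse_stereographic_eq_iff)
  qed
  note H = mean_curvature_eq_0[OF cell assms(2) ad]
  have "critical_for_total_area D \<sigma> f\<theta>" if fin: "finite_complex D"
    unfolding critical_for_total_area_def
  proof (intro allI impI)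
    fix g assume g: "vanishes_on_boundary D g"
    have "((\<lambda>t. \<sigma> v * norm (dual_face_area D (\<lambda>\<phi>. f\<theta> \<phi> + t *\<^sub>R g \<phi>) v))
        has_real_derivative N v \<bullet> area_variation D f\<theta> g v) (at 0)"
      if v: "v \<in> interior_verts D" for v
    proof -
      have vv: "v \<in> verts D" using v by (simp add: interior_verts_def)
      obtain c where "dual_face_area D f\<theta> v = c *\<^sub>R N v"
        using dual_face_area_parallel_normal[OF cell assms(2) ad v deg[OF v] unit[OF vv]] .
      then show ?thesis
        using signed_area_has_derivative[OF cell vv unit[OF vv]] assms(8,9) v by blast
    qed
    then have "((\<lambda>t. total_area D \<sigma> (\<lambda>\<phi>. f\<theta> \<phi> + t *\<^sub>R g \<phi>)) has_real_derivative
        (\<Sum>v\<in>interior_verts D. N v \<bullet> area_variation D f\<theta> g v)) (at 0)"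
      unfolding total_area_def by (intro DERIV_sum)
    then show "((\<lambda>t. total_area D \<sigma> (\<lambda>\<phi>. f\<theta> \<phi> + t *\<^sub>R g \<phi>)) has_real_derivative 0) (at 0)"
      using sum_area_variation_eq_0[OF cell fin H(1) g] by simp
  qed
  then show ?thesis using H by simp
qed

end
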